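(* Let $n\geq 4$ be an integer. If $\Delta^o(S_n)^*$ is connected, then $\operatorname{diam}(\Delta^o(S_n)^* )\leq 3$.
   Context: $S_n$ is the symmetric group of degree $n$. For a finite group $G$, $o(g)$ denotes the order of $g\in G$, and the order super commuting graph $\Delta^o(G)$ is the simple undirected graph with vertex set $G$ in which two distinct elements $g,h$ are adjacent iff either $o(g)=o(h)$, or there exist $g',h'\in G$ with $o(g')=o(g)$, $o(h')=o(h)$ such that $g'$ and $h'$ are distinct and commute. A vertex is dominant if it is adjacent to every other vertex. The reduced order super commuting graph $\Delta^o(G)^*$ is the induced subgraph of $\Delta^o(G)$ obtained by deleting all dominant vertices of $\Delta^o(G)$. The diameter $\operatorname{diam}$ of a connected graph is the maximum distance between two of its vertices. *)

theory Defs
  imports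
    "HOL-Algebra.Sym_Groups"
    "HOL-Algebra.Multiplicative_Group"
    "Graph_Theory.Digraph_Component"
    "Graph_Theory.Shortest_Path"
begin

text \<open>
  A simple undirected graph is represented, as in the AFP entry on graph theory, by a symmetric
  loop-free digraph: each edge is a pair of opposite arcs.
\<close>

definition order_super_commuting_graph :: "('a, 'm) monoid_scheme \<Rightarrow> 'a pair_pre_digraph"
  where "order_super_commuting_graph G =
    \<lparr> pverts = carrier G,
      parcs = {(g, h). g \<in> carrier G \<and> h \<in> carrier G \<and> g \<noteq> h \<and>
        (group.ord G g = group.ord G h \<or>
         (\<exists>g' \<in> carrier G. \<exists>h' \<in> carrier G.
            group.ord G g' = group.ord G g \<and> group.ord G h' = group.ord G h \<and>
            g' \<noteq> h' \<and> g' \<otimes>\<^bsub>G\<^esub> h' = h' \<otimes>\<^bsub>G\<^esub> g'))} \<rparr>"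

definition dominant_vertex :: "('a, 'b) pre_digraph \<Rightarrow> 'a \<Rightarrow> bool"
  where "dominant_vertex \<Gamma> v \<longleftrightarrow>
    v \<in> verts \<Gamma> \<and> (\<forall>w \<in> verts \<Gamma>. w \<noteq> v \<longrightarrow> v \<rightarrow>\<^bsub>\<Gamma>\<^esub> w)"

definition reduced_order_super_commuting_graph ::
    "('a, 'm) monoid_scheme \<Rightarrow> ('a, 'a \<times> 'a) pre_digraph"
  where "reduced_order_super_commuting_graph G =
    (let \<Gamma> = with_proj (order_super_commuting_graph G)
     in \<Gamma> \<restriction> {v \<in> verts \<Gamma>. \<not> dominant_vertex \<Gamma> v})"

text \<open>
  The distance is the infimum of the lengths of the walks between two vertices,
  i.e. the minimal cost for unit arc weights; it is infinite if there is no walk.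
\<close>

definition graph_dist :: "('a, 'b) pre_digraph \<Rightarrow> 'a \<Rightarrow> 'a \<Rightarrow> ereal"
  where "graph_dist \<Gamma> u v = wf_digraph.\<mu> \<Gamma> (\<lambda>_. 1) u v"

text \<open>
  For a finite nonempty vertex set the supremum is a maximum. (It is \<open>-\<infinity>\<close> for the
  graph without vertices, which \<^const>\<open>Digraph_Component.connected\<close> excludes.)
\<close>

definition graph_diameter :: "('a, 'b) pre_digraph \<Rightarrow> ereal"
  where "graph_diameter \<Gamma> = (SUP u \<in> verts \<Gamma>. SUP v \<in> verts \<Gamma>. graph_dist \<Gamma> u v)"

lemma pair_graph_order_super_commuting_graph:
  assumes "finite (carrier G)"
  shows "pair_graph (order_super_commuting_graph G)"
proof
  show "finite (parcs (order_super_commuting_graph G))"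
    by (rule finite_subset[of _ "carrier G \<times> carrier G"])
       (use assms in \<open>auto simp: order_super_commuting_graph_def\<close>)
  show "symmetric (with_proj (order_super_commuting_graph G))"
    unfolding symmetric_def sym_def
    by (simp add: order_super_commuting_graph_def) metis
qed (use assms in \<open>auto simp: order_super_commuting_graph_def\<close>)

end

theory Submission
  imports
    Defs
    "HOL-Library.Discrete_Functions"
    "HOL-Combinatorics.Orbits"
    "HOL-Number_Theory.Prime_Powers"
begin

text \<open>
  Adjacency depends only on element orders, and for distinct primes \<open>p\<close> and \<open>q\<close> elements of these
  orders commute for a suitable choice iff \<open>p + q \<le> n\<close>. More generally, if pairwise coprime prime
  powers all divide the order of a permutation of \<open>n\<close> points, their sum is at most \<open>n\<close>.

  No element of prime order \<open>p\<close> is dominant: by Bertrand's postulate one can greedily find pairwise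
  coprime prime powers, coprime to \<open>p\<close>, with sum in \<open>{n - p + 1..n}\<close>, and their product is an order
  not adjacent to \<open>p\<close>. If \<open>n\<close> or \<open>n - 1\<close> were a prime \<open>p\<close>, the elements of order \<open>p\<close> would form a component
  of their own; so connectedness makes every prime order \<open>p \<le> n\<close> adjacent (or equal) to 2.

  Now let \<open>a\<close> and \<open>b\<close> be the orders of two vertices. If there are primes \<open>p\<close> dividing \<open>a\<close> and \<open>q\<close> dividing \<open>b\<close>
  with \<open>p = q\<close> or \<open>p + q \<le> n\<close>, then \<open>a, p, q, b\<close> is a walk. Otherwise, with \<open>p < q\<close> say, necessarily
  \<open>b = q\<close>, and \<open>a, p, 2, q\<close> is a walk.
\<close>

section \<open>Bertrand's postulate\<close>

lemma prod_pairwise_coprime_dvd: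
  fixes m :: nat
  assumes "finite P" "pairwise coprime P" "\<And>p. p \<in> P \<Longrightarrow> p dvd m"
  shows "\<Prod>P dvd m"
  using assms
proof (induction P rule: finite_induct)
  case (insert p P)
  have "coprime p (\<Prod>P)"
    using insert by (intro prod_coprime_right) (auto simp: pairwise_insert)
  then show ?case
    using insert by (simp add: divides_mult pairwise_insert)
qed auto

lemma pairwise_coprime_primes:
  assumes "\<And>p. p \<in> P \<Longrightarrow> prime (p :: nat)"
  shows "pairwise coprime P"
  using assms by (intro pairwiseI primes_coprime) auto

text \<open>The two middle coefficients of row 2m + 1 are equal and together at most the row sum 2 *
  4^m.\<close>

lemma odd_central_binomial_le: "(2 * m + 1) choose m \<le> 4 ^ m"
proof -
  have "2 * ((2 * m + 1) choose m) = ((2 * m + 1) choose m) + ((2 * m + 1) choose (m + 1))"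
    using binomial_symmetric[of m "2 * m + 1"] by simp
  also have "\<dots> = (\<Sum>k\<in>{m, m + 1}. (2 * m + 1) choose k)"
    by simp
  also have "\<dots> \<le> (\<Sum>k\<le>2 * m + 1. (2 * m + 1) choose k)"
    by (rule sum_mono2) auto
  also have "\<dots> = 2 * 4 ^ m"
    by (subst choose_row_sum) (simp add: power_mult power_add)
  finally show ?thesis by simp
qed

text \<open>Erdos's induction. An even n > 2 is not prime, so the product is that for n - 1. For n =
  2m + 1 the primes in (m + 1, n] contribute at most 4^m, because their product divides
  \<open>n choose m\<close>; the primes up to m + 1 are covered by the induction hypothesis.\<close>

lemma primorial_le: "\<Prod>{p. prime p \<and> p \<le> n} \<le> (4 :: nat) ^ n"
proof (induction n rule: less_induct)
  case (less n)
  consider "n \<le> 1" | "n = 2" | "n > 2" "even n" | "n > 2" "odd n"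
    by linarith
  then show ?case
  proof cases
    case 1
    then have "{p. prime p \<and> p \<le> n} = {}"
      by (auto dest: prime_ge_2_nat)
    then show ?thesis by (simp only: prod.empty) simp
  next
    case 2
    have "{p. prime p \<and> p \<le> 2} = {2 :: nat}"
      by (auto dest: prime_ge_2_nat intro: antisym)
    with 2 show ?thesis by simp
  next
    case 3
    then have "\<not> prime n"
      using prime_odd_nat by blast
    then have "{p. prime p \<and> p \<le> n} = {p. prime p \<and> p \<le> n - 1}"
      using 3 by (auto simp: le_less)
    also have "\<Prod>\<dots> \<le> 4 ^ (n - 1)"
      using 3 by (intro less) auto
    also have "\<dots> \<le> 4 ^ n"
      by (intro power_increasing) auto
    finally show ?thesis .
  next
    case 4
    then obtain m where n: "n = 2 * m + 1"
      by (elim oddE)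
    with 4 have m: "m \<ge> 1" by simp
    let ?A = "{p. prime p \<and> p \<le> m + 1}" and ?B = "{p. prime p \<and> m + 1 < p \<and> p \<le> n}"
    have "\<Prod>?B dvd n choose m"
    proof (rule prod_pairwise_coprime_dvd)
      fix p assume "p \<in> ?B"
      then have p: "prime p" "m + 1 < p" "p \<le> n" by auto
      have "fact m * fact (n - m) * (n choose m) = fact n"
        by (rule binomial_fact_lemma) (simp add: n)
      moreover have "p dvd fact n" "\<not> p dvd fact m" "\<not> p dvd fact (n - m)"
        using p by (simp_all add: prime_dvd_fact_iff n del: fact_Suc)
      ultimately show "p dvd n choose m"
        using p(1) by (metis prime_dvd_multD)
    qed (auto intro!: pairwise_coprime_primes)
    then have "\<Prod>?B \<le> n choose m"
      by (rule dvd_imp_le) (simp add: n)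
    also have "\<dots> \<le> 4 ^ m"
      unfolding n by (rule odd_central_binomial_le)
    finally have B: "\<Prod>?B \<le> 4 ^ m" .
    have A: "\<Prod>?A \<le> 4 ^ (m + 1)"
      using m n by (intro less) auto
    have "{p. prime p \<and> p \<le> n} = ?A \<union> ?B"
      using m n by auto
    then have "\<Prod>{p. prime p \<and> p \<le> n} = \<Prod>?A * \<Prod>?B"
      by (simp only:) (rule prod.union_disjoint, auto)
    also have "\<dots> \<le> 4 ^ (m + 1) * 4 ^ m"
      using A B by (rule mult_le_mono)
    also have "\<dots> = 4 ^ n"
      by (simp add: n mult_2 power_add)
    finally show ?thesis .
  qed
qed

section \<open>Prime factorization of central binomial coefficients\<close>

lemma multiplicity_eq_card:
  fixes p m :: nat
  assumes "prime p" "m > 0" "m < p ^ Suc L"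
  shows "multiplicity p m = card {i \<in> {1..L}. p ^ i dvd m}"
proof -
  have unit: "\<not> is_unit p" using assms(1) by auto
  have "p ^ multiplicity p m \<le> m"
    using assms by (intro dvd_imp_le multiplicity_dvd) auto
  then have "p ^ multiplicity p m < p ^ Suc L"
    using assms(3) by linarith
  then have "multiplicity p m \<le> L"
    using prime_gt_1_nat[OF assms(1)] by (simp add: power_strict_increasing_iff del: power_Suc)
  then have "{i \<in> {1..L}. p ^ i dvd m} = {1..multiplicity p m}"
    using assms unit by (auto simp: power_dvd_iff_le_multiplicity)
  then show ?thesis by simp
qed

text \<open>Passing from m to m + 1 raises the i-th quotient by one exactly when
  \<open>p ^ i\<close> divides m + 1, and the number of such i is the multiplicity of p in m + 1.
  The cutoff \<open>L\<close> loses no term since \<open>p ^ Suc L\<close> exceeds m.\<close>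

lemma legendre_formula:
  fixes p m :: nat
  assumes "prime p" "m < p ^ Suc L"
  shows "multiplicity p (fact m :: nat) = (\<Sum>i=1..L. m div p ^ i)"
  using assms(2)
proof (induction m)
  case (Suc m)
  have "multiplicity p (fact (Suc m) :: nat) = multiplicity p (Suc m) + multiplicity p (fact m :: nat)"
    unfolding fact_Suc of_nat_id
    using assms(1) by (intro prime_elem_multiplicity_mult_distrib) auto
  also have "\<dots> = (\<Sum>i=1..L. if p ^ i dvd Suc m then 1 else 0) + (\<Sum>i=1..L. m div p ^ i)"
    using Suc assms(1) multiplicity_eq_card[of p "Suc m" L]
    by (simp add: sum.If_cases Int_def conj_commute)
  also have "\<dots> = (\<Sum>i=1..L. Suc m div p ^ i)"
    unfolding sum.distrib[symmetric] by (intro sum.cong) (auto simp: div_Suc dvd_eq_mod_eq_0)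
  finally show ?case .
qed simp

lemma multiplicity_central_binomial:
  fixes p n :: nat
  assumes "prime p" "2 * n < p ^ Suc L"
  shows "multiplicity p ((2 * n) choose n) + 2 * (\<Sum>i=1..L. n div p ^ i) = (\<Sum>i=1..L. (2 * n) div p ^ i)"
proof -
  have "fact n * fact (2 * n - n) * ((2 * n) choose n) = fact (2 * n)"
    by (rule binomial_fact_lemma) simp
  then have "fact n * (fact n * ((2 * n) choose n)) = (fact (2 * n) :: nat)"
    by (simp add: mult_2 mult.assoc)
  then have "multiplicity p (fact (2 * n) :: nat) = multiplicity p (fact n * (fact n * ((2 * n) choose n)) :: nat)"
    by simp
  also have "\<dots> = multiplicity p (fact n :: nat) + (multiplicity p (fact n :: nat) + multiplicity p ((2 * n) choose n))"
    using assms(1) by (simp add: prime_elem_multiplicity_mult_distrib)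
  finally show ?thesis
    using legendre_formula[of p n L] legendre_formula[of p "2 * n" L] assms by simp
qed

text \<open>With \<open>p ^ L \<le> 2 * n < p ^ Suc L\<close>, each of the L differences between the
  quotient of 2n and twice the quotient of n is at most 1, so the multiplicity of p is at most
  L.\<close>

lemma prime_power_central_binomial_le:
  fixes p n :: nat
  assumes "prime p" "n > 0"
  shows "p ^ multiplicity p ((2 * n) choose n) \<le> 2 * n"
proof -
  have p: "p > 1" using assms prime_gt_1_nat by blast
  obtain L where L: "p ^ L \<le> 2 * n" "2 * n < p ^ Suc L"
    using ex_power_ivl1[of p "2 * n"] p assms by auto
  have "(\<Sum>i=1..L. (2 * n) div p ^ i) \<le> (\<Sum>i=1..L. 2 * (n div p ^ i) + 1)"
  proof (rule sum_mono)
    fix i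
    have "2 * n < 2 * (n div p ^ i + 1) * p ^ i"
      using p dividend_less_div_times[of "p ^ i" n] by (simp add: algebra_simps)
    then have "(2 * n) div p ^ i < 2 * (n div p ^ i + 1)"
      by (rule less_mult_imp_div_less)
    then show "(2 * n) div p ^ i \<le> 2 * (n div p ^ i) + 1" by simp
  qed
  also have "\<dots> = 2 * (\<Sum>i=1..L. n div p ^ i) + L"
    by (simp add: sum.distrib sum_distrib_left del: add_Suc_right One_nat_def)
  finally have "multiplicity p ((2 * n) choose n) \<le> L"
    using multiplicity_central_binomial[OF assms(1) L(2)] by linarith
  then have "p ^ multiplicity p ((2 * n) choose n) \<le> p ^ L"
    using p by (intro power_increasing) auto
  with L show ?thesis by linarith
qed

text \<open>Here 2n < 3p \<le> p^2, so p occurs twice in (2n)! (from p and 2p) and once in each of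
  the two factors n!, and these cancel.\<close>

lemma multiplicity_central_binomial_eq_0:
  fixes p n :: nat
  assumes "prime p" "p \<ge> 3" "p \<le> n" "2 * n < 3 * p"
  shows "multiplicity p ((2 * n) choose n) = 0"
proof -
  have "3 * p \<le> p * p" using assms by simp
  then have "2 * n < p * p" using assms(4) by linarith
  then have "2 * n < p ^ Suc 1" by simp
  moreover have "n div p = 1" "(2 * n) div p = 2"
    using assms by (auto intro!: div_nat_eqI)
  ultimately show ?thesis
    using multiplicity_central_binomial[of p n 1] assms(1) by simp
qed

text \<open>The prime factors are split at the square root of 2n. The small ones lie in {2..s} and
  each contributes a power of at most 2n. The large ones occur to the first power and are at most
  2n/3, so the primorial bound applies to their product.\<close>

lemma central_binomial_le_if_no_prime:
  fixes n s :: nat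
  assumes n: "n \<ge> 3" and none: "\<And>p. prime p \<Longrightarrow> n < p \<Longrightarrow> p > 2 * n"
    and s: "2 * n < (s + 1)\<^sup>2"
  shows "(2 * n) choose n \<le> (2 * n) ^ (s - 1) * 4 ^ (2 * n div 3)"
proof -
  let ?C = "(2 * n) choose n"
  let ?P = "prime_factors ?C"
  let ?A = "{p \<in> ?P. p\<^sup>2 \<le> 2 * n}" and ?B = "{p \<in> ?P. 2 * n < p\<^sup>2}"
  let ?m = "\<lambda>p. multiplicity p ?C"
  have P: "prime p" "?m p > 0" if "p \<in> ?P" for p
    using that by (auto simp: prime_factors_multiplicity)
  have le: "p ^ ?m p \<le> 2 * n" if "p \<in> ?P" for p
    using prime_power_central_binomial_le[of p n] P that n by auto
  have small: "p \<le> 2 * n div 3" if p: "p \<in> ?P" for p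
  proof (rule ccontr)
    assume "\<not> p \<le> 2 * n div 3"
    then have *: "2 * n < 3 * p" by linarith
    have "p ^ 1 \<le> p ^ ?m p"
      using P[OF p] prime_gt_0_nat by (intro power_increasing) (auto simp: Suc_le_eq)
    with le[OF p] have "p \<le> n"
      using none[of p] P[OF p] by force
    moreover have "p \<ge> 3" using * n by linarith
    ultimately show False
      using multiplicity_central_binomial_eq_0[of p n] P[OF p] * by simp
  qed
  have "(\<Prod>p\<in>?A. p ^ ?m p) \<le> (\<Prod>p\<in>?A. 2 * n)"
    by (rule prod_mono) (use le in auto)
  also have "\<dots> = (2 * n) ^ card ?A" by simp
  also have "\<dots> \<le> (2 * n) ^ (s - 1)"
  proof (rule power_increasing)
    have "?A \<subseteq> {2..s}"
    proof safe
      fix p assume "p \<in> ?P" "p\<^sup>2 \<le> 2 * n"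
      then have "p\<^sup>2 < (s + 1)\<^sup>2" using s by linarith
      then have "p < s + 1" by (rule power_less_imp_less_base) simp
      then show "p \<in> {2..s}" using P(1)[OF \<open>p \<in> ?P\<close>] by (auto dest: prime_ge_2_nat)
    qed
    then show "card ?A \<le> s - 1"
      using card_mono[of "{2..s}" ?A] by simp
  qed (use n in auto)
  finally have A: "(\<Prod>p\<in>?A. p ^ ?m p) \<le> (2 * n) ^ (s - 1)" .
  have "(\<Prod>p\<in>?B. p ^ ?m p) \<le> \<Prod>?B"
  proof (rule prod_mono, safe)
    fix p assume p: "p \<in> ?P" "2 * n < p\<^sup>2"
    then have "p ^ ?m p < p ^ 2" using le[of p] by linarith
    then have "?m p < 2"
      using prime_gt_1_nat[OF P(1)[OF p(1)]] by (simp add: power_strict_increasing_iff)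
    then have "?m p = 1" using P(2)[OF p(1)] by linarith
    then show "p ^ ?m p \<le> p" by simp
  qed
  also have "\<dots> \<le> \<Prod>{p. prime p \<and> p \<le> 2 * n div 3}"
    by (rule dvd_imp_le, rule prod_dvd_prod_subset)
       (use P(1) small in \<open>auto intro!: prod_pos prime_gt_0_nat\<close>)
  also have "\<dots> \<le> 4 ^ (2 * n div 3)"
    by (rule primorial_le)
  finally have B: "(\<Prod>p\<in>?B. p ^ ?m p) \<le> 4 ^ (2 * n div 3)" .
  have "?C = (\<Prod>p\<in>?P. p ^ ?m p)"
    using prod_prime_factors[of ?C] by simp
  also have "\<dots> = (\<Prod>p\<in>?A \<union> ?B. p ^ ?m p)"
    by (rule prod.cong) auto
  also have "\<dots> = (\<Prod>p\<in>?A. p ^ ?m p) * (\<Prod>p\<in>?B. p ^ ?m p)"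
    by (rule prod.union_disjoint) auto
  also have "\<dots> \<le> (2 * n) ^ (s - 1) * 4 ^ (2 * n div 3)"
    using A B by (rule mult_le_mono)
  finally show ?thesis .
qed

section \<open>Numerical comparison and the small cases of Bertrand's postulate\<close>

lemma square_le_two_power: "9 * (k + 1)\<^sup>2 \<le> (2 :: nat) ^ k" if "k \<ge> 11"
  using that
proof (induction k rule: dec_induct)
  case (step k)
  have "9 * (Suc k + 1)\<^sup>2 \<le> 2 * (9 * (k + 1)\<^sup>2)"
    using step(1) mult_le_mono[of 11 k 11 k] by (simp add: power2_eq_square algebra_simps)
  with step.IH show ?case by simp
qed simp

text \<open>Without a prime in (n, 2n], the upper bound on the central binomial coefficient
  contradicts the lower bound 4^n / (2n). With x = 2n < 2^(k+1) and s the integer square root of x,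
  the comparison reduces to 3(k + 1)s \<le> x, which follows from (3(k + 1))^2 \<le> x and s^2 \<le>
  x.\<close>

lemma bertrand_large:
  fixes n :: nat
  assumes "n \<ge> 631"
  shows "\<exists>p. prime p \<and> n < p \<and> p \<le> 2 * n"
proof (rule ccontr)
  assume "\<not> ?thesis"
  then have none: "\<And>p. prime p \<Longrightarrow> n < p \<Longrightarrow> p > 2 * n" by (meson not_le)
  define x where "x = 2 * n"
  define s where "s = floor_sqrt x"
  have s: "s\<^sup>2 \<le> x" "x < (s + 1)\<^sup>2"
    using floor_sqrt_power2_le[of x] Suc_floor_sqrt_power2_gt[of x] by (simp_all add: s_def)
  have x: "x \<ge> 1262" using assms by (simp add: x_def)
  have s0: "s > 0" using s x by (cases s) auto
  obtain k where k: "2 ^ k \<le> x" "x < 2 ^ Suc k"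
    using ex_power_ivl1[of 2 x] x by auto
  have "(2 :: nat) ^ 10 < 2 ^ Suc k" using k x by simp
  then have "10 < Suc k" by (rule power_less_imp_less_exp[rotated]) simp
  then have "k \<ge> 10" by simp
  then have k2: "(3 * (k + 1))\<^sup>2 \<le> x"
  \<comment> \<open>For k = 10 the power 2^10 is too small, but 33^2 = 1089 is below 1262 \<le>
    x.\<close>
  proof (cases "k = 10")
    case False
    with \<open>k \<ge> 10\<close> have "9 * (k + 1)\<^sup>2 \<le> 2 ^ k" by (intro square_le_two_power) simp
    with k show ?thesis by (simp only: power_mult_distrib) simp
  qed (use x in simp)
  have "4 ^ n / (2 * real n) \<le> real ((2 * n) choose n)"
    using assms by (intro central_binomial_lower_bound) simp
  then have "real (4 ^ n) \<le> real (x * (x choose n))"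
    using assms by (simp add: x_def field_simps)
  then have "4 ^ n \<le> x * (x choose n)"
    by (simp only: of_nat_le_iff)
  also have "\<dots> \<le> x * (x ^ (s - 1) * 4 ^ (x div 3))"
    using central_binomial_le_if_no_prime[of n s] none s assms by (simp add: x_def)
  also have "\<dots> = x ^ s * 4 ^ (x div 3)"
    using s0 by (cases s) auto
  finally have "4 ^ (n - x div 3) * 4 ^ (x div 3) \<le> x ^ s * 4 ^ (x div 3)"
    unfolding power_add[symmetric] by (simp add: x_def)
  then have "(4 :: nat) ^ (n - x div 3) \<le> x ^ s" by simp
  \<comment> \<open>Cubing removes the division: 3(n - x div 3) \<ge> 3n - 2n = n, and 4^n =
    2^x.\<close>
  then have "((4 :: nat) ^ (n - x div 3)) ^ 3 \<le> (x ^ s) ^ 3"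
    by (rule power_mono) simp
  moreover have "(2 :: nat) ^ x \<le> (4 ^ (n - x div 3)) ^ 3"
  proof -
    have "(2 :: nat) ^ x = 4 ^ n" by (simp add: x_def power_mult)
    also have "\<dots> \<le> 4 ^ ((n - x div 3) * 3)"
      by (rule power_increasing) (auto simp: x_def)
    finally show ?thesis by (simp add: power_mult)
  qed
  moreover have "(x ^ s) ^ 3 < ((2 ^ Suc k) ^ s) ^ 3"
    using k s0 by (intro power_strict_mono) auto
  moreover have "((2 ^ Suc k) ^ s) ^ 3 = (2 :: nat) ^ (3 * (k + 1) * s)"
    by (simp add: power_mult[symmetric] algebra_simps del: power_Suc)
  moreover have "(2 :: nat) ^ (3 * (k + 1) * s) \<le> 2 ^ x"
  proof (rule power_increasing)
    have "(3 * (k + 1) * s)\<^sup>2 \<le> x * x"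
      using mult_le_mono[OF k2 s(1)] by (simp only: power_mult_distrib)
    then have "(3 * (k + 1) * s)\<^sup>2 \<le> x\<^sup>2"
      by (simp add: power2_eq_square)
    then show "3 * (k + 1) * s \<le> x"
      by (rule power2_le_imp_le) simp
  qed simp
  ultimately show False by linarith
qed

lemma bertrand:
  fixes n :: nat
  assumes "n \<ge> 1"
  shows "\<exists>p. prime p \<and> n < p \<and> p \<le> 2 * n"
proof (cases "n \<ge> 631")
  case False
  \<comment> \<open>Each prime in the chain 2, 3, 5, 7, 13, ..., 631 is at most twice its
    predecessor r. If r \<le> n < q, then q is a witness; otherwise n < r and the search moves down
    the chain.\<close>
  have step: ?thesis if "n < q" "prime q" "q \<le> 2 * r" "n < r \<Longrightarrow> ?thesis" for q r
    using that by (cases "n < r") auto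
  have 2: ?thesis if "n < 2"
    using that assms by (intro exI[of _ 2]) auto
  have 3: ?thesis if "n < 3"
    by (rule step[of 3 2]) (use that 2 in simp_all)
  have 5: ?thesis if "n < 5"
    by (rule step[of 5 3]) (use that 3 in simp_all)
  have 7: ?thesis if "n < 7"
    by (rule step[of 7 5]) (use that 5 in simp_all)
  have 13: ?thesis if "n < 13"
    by (rule step[of 13 7]) (use that 7 in simp_all)
  have 23: ?thesis if "n < 23"
    by (rule step[of 23 13]) (use that 13 in simp_all)
  have 43: ?thesis if "n < 43"
    by (rule step[of 43 23]) (use that 23 in simp_all)
  have 83: ?thesis if "n < 83"
    by (rule step[of 83 43]) (use that 43 in simp_all)
  have 163: ?thesis if "n < 163"
    by (rule step[of 163 83]) (use that 83 in simp_all)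
  have 317: ?thesis if "n < 317"
    by (rule step[of 317 163]) (use that 163 in simp_all)
  have 631: ?thesis if "n < 631"
    by (rule step[of 631 317]) (use that 317 in simp_all)
  show ?thesis using 631 False by simp
qed (rule bertrand_large)

section \<open>Sums of coprime prime powers\<close>

text \<open>Such a \<open>Q\<close> serves as a set of cycle lengths: a permutation of n points of
  order \<open>\<Prod>Q\<close> exists iff \<open>\<Sum>Q \<le> n\<close>. Powers are allowed
  because a power of 2 is used to fill short gaps.\<close>

definition coprime_primepows :: "nat set \<Rightarrow> bool"
  where "coprime_primepows Q \<longleftrightarrow> finite Q \<and> (\<forall>q\<in>Q. primepow q) \<and> pairwise coprime Q"

lemma coprime_primepows_primes:
  assumes "finite Q" "\<And>q. q \<in> Q \<Longrightarrow> prime q"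
  shows "coprime_primepows Q"
  using assms by (simp add: coprime_primepows_def pairwise_coprime_primes)

section \<open>Greedy sums that come close to n\<close>

lemma bertrand_half:
  fixes n :: nat
  assumes "n \<ge> 2"
  obtains r where "prime r" "n div 2 < r" "r \<le> n"
proof -
  obtain r where "prime r" "n div 2 < r" "r \<le> 2 * (n div 2)"
    using bertrand[of "n div 2"] assms by (auto simp: Suc_le_eq div_greater_zero_iff)
  then show thesis by (intro that[of r]) auto
qed

text \<open>Strong induction on n. Below p the empty set suffices, and between p and 2p the largest
  power of 2 up to n. From 2p on, a prime r > n/2 is split off and the remainder n - r is treated
  recursively.\<close>

lemma odd_prime_window:
  fixes p n :: nat
  assumes "prime p" "odd p"
  shows "\<exists>Q. coprime_primepows Q \<and> (\<forall>q\<in>Q. coprime p q) \<and> \<Sum>Q \<le> n \<and> n < \<Sum>Q + p"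
proof (induction n rule: less_induct)
  case (less n)
  have p: "p \<ge> 3"
    using assms prime_ge_2_nat[of p] by (cases "p = 2") auto
  consider "n < p" | "p \<le> n" "n < 2 * p" | "n \<ge> 2 * p" by linarith
  then show ?case
  proof cases
    case 1
    then show ?thesis
      by (intro exI[of _ "{}"]) (simp add: coprime_primepows_def)
  next
    case 2
    obtain k where k: "2 ^ k \<le> n" "n < 2 ^ Suc k"
      using ex_power_ivl1[of 2 n] 2 p by auto
    with 2 p have "k > 0" by (cases k) auto
    moreover have "coprime p (2 ^ k)" using assms by simp
    ultimately show ?thesis
      using k 2 by (intro exI[of _ "{2 ^ k}"]) (auto simp: coprime_primepows_def)
  next
    case 3
    obtain r where r: "prime r" "n div 2 < r" "r \<le> n"
      using bertrand_half[of n] 3 p by auto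
    have "r > p" using 3 r by linarith
    obtain Q where Q: "coprime_primepows Q" "\<forall>q\<in>Q. coprime p q"
      "\<Sum>Q \<le> n - r" "n - r < \<Sum>Q + p"
      using less[of "n - r"] r by (auto simp: prime_gt_0_nat)
    have fin: "finite Q" using Q by (simp add: coprime_primepows_def)
    \<comment> \<open>Every element of \<open>Q\<close> is at most n - r, hence below r; this makes
      the prime r coprime to all of them.\<close>
    have lt: "q < r" "q > 0" if "q \<in> Q" for q
    proof -
      have "q \<le> \<Sum>Q" using member_le_sum[of q Q "\<lambda>q. q"] that fin by simp
      with Q r show "q < r" by linarith
      show "q > 0" using that Q by (auto simp: coprime_primepows_def primepow_gt_0_nat)
    qed
    then have "coprime r q" if "q \<in> Q" for q
      using that r by (auto intro!: prime_imp_coprime dest: nat_dvd_not_less)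
    moreover have "coprime p r"
      using \<open>r > p\<close> assms r by (intro primes_coprime) auto
    moreover have "r \<notin> Q" using lt by blast
    ultimately show ?thesis
      using Q r fin
      by (intro exI[of _ "insert r Q"])
         (auto simp: coprime_primepows_def pairwise_insert coprime_commute)
  qed
qed

text \<open>
  Richert's argument: for \<open>t \<ge> 14\<close>, Bertrand's postulate gives a prime \<open>r \<ge> 11\<close> with
  \<open>r + 3 \<le> t \<le> 2 r + 2\<close>, so that \<open>t - r\<close> is again between 3 and \<open>r + 2\<close>. The remainder 2, the only
  one that fails, is never reached.
\<close>

lemma sum_odd_primes:
  fixes q t :: nat
  assumes "prime q" "q \<ge> 11" "3 \<le> t" "t \<le> q + 2"
  shows "\<exists>Q. finite Q \<and> (\<forall>r\<in>Q. prime r \<and> odd r \<and> r < q) \<and> \<Sum>Q \<le> t \<and> t < \<Sum>Q + 2"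
  using assms
proof (induction t arbitrary: q rule: less_induct)
  case (less t)
  show ?case
  proof (cases "t \<le> 13")
    case True
    have primes: "prime (3 :: nat)" "prime (5 :: nat)" "prime (7 :: nat)" by simp_all
    have *: ?thesis if "P \<subseteq> {3, 5, 7}" "\<Sum>P \<le> t" "t < \<Sum>P + 2" for P
      using that primes less.prems finite_subset[OF that(1)] by (intro exI[of _ P]) auto
    consider "t \<le> 4" | "5 \<le> t" "t \<le> 6" | "t = 7" | "8 \<le> t" "t \<le> 9" | "10 \<le> t" "t \<le> 11" | "12 \<le> t"
      by linarith
    then show ?thesis
    proof cases
      case 1 then show ?thesis using less.prems by (intro *[of "{3}"]) auto
    next
      case 2 then show ?thesis by (intro *[of "{5}"]) auto
    next
      case 3 then show ?thesis by (intro *[of "{7}"]) auto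
    next
      case 4 then show ?thesis by (intro *[of "{3, 5}"]) auto
    next
      case 5 then show ?thesis by (intro *[of "{3, 7}"]) auto
    next
      case 6 then show ?thesis using True by (intro *[of "{5, 7}"]) auto
    qed
  next
    case False
    obtain r where r: "prime r" "r \<ge> 11" "r + 3 \<le> t" "t \<le> 2 * r + 2"
    proof -
      obtain r where r: "prime r" "(t - 3) div 2 < r" "r \<le> t - 3"
      proof (rule bertrand_half)
        show "2 \<le> t - 3" using False by simp
      qed
      show thesis
      proof (cases "r \<ge> 11")
        case True
        with r False show thesis by (intro that[of r]) auto
      next
        case False
        \<comment> \<open>A Bertrand prime below 11 forces t \<le> 22, and for 14 \<le> t \<le> 22
          the prime 11 meets both bounds.\<close>
        have "prime (11 :: nat)" by simp
        with False r \<open>\<not> t \<le> 13\<close> show thesis by (intro that[of 11]) auto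
      qed
    qed
    have "\<exists>Q. finite Q \<and> (\<forall>s\<in>Q. prime s \<and> odd s \<and> s < r) \<and> \<Sum>Q \<le> t - r \<and> t - r < \<Sum>Q + 2"
      by (rule less.IH) (use r in \<open>linarith | assumption\<close>)+
    then obtain Q where Q: "finite Q" "\<forall>s\<in>Q. prime s \<and> odd s \<and> s < r" "\<Sum>Q \<le> t - r" "t - r < \<Sum>Q + 2"
      by blast
    have "r \<notin> Q" using Q by blast
    moreover have "odd r" using r prime_odd_nat[of r] by simp
    moreover have "\<forall>s\<in>insert r Q. s < q"
    proof
      fix s assume "s \<in> insert r Q"
      then have "s \<le> r" using Q(2) by (metis insertE less_imp_le order_refl)
      with r(3) less.prems(4) show "s < q" by linarith
    qed
    ultimately show ?thesis
      using Q r(1,3) by (intro exI[of _ "insert r Q"], simp, linarith)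
  qed
qed

lemma prime_window:
  fixes p n :: nat
  assumes "prime p" "n \<ge> 3"
  obtains Q where "coprime_primepows Q" "\<And>q. q \<in> Q \<Longrightarrow> coprime p q" "\<Sum>Q \<le> n" "n < \<Sum>Q + p"
proof (cases "odd p")
  case True
  then show thesis using odd_prime_window[OF assms(1), of n] that by blast
next
  case False
  then have p: "p = 2" using assms(1) primes_dvd_imp_eq two_is_prime_nat by blast
  \<comment> \<open>The summands are drawn from the primes below q; a prime above n + 11 leaves
    enough room for the target n.\<close>
  obtain q where "prime q" "q > n + 11" using bigger_prime by blast
  then obtain Q where "finite Q" "\<forall>r\<in>Q. prime r \<and> odd r \<and> r < q" "\<Sum>Q \<le> n" "n < \<Sum>Q + 2"
    using sum_odd_primes[of q n] assms by auto
  then show thesis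
    by (intro that[of Q]) (auto simp: p intro!: coprime_primepows_primes)
qed

section \<open>Orders of permutations\<close>

lemma (in group) ord_mult_coprime:
  assumes x: "x \<in> carrier G" and y: "y \<in> carrier G" and comm: "x \<otimes> y = y \<otimes> x"
    and cop: "coprime (ord x) (ord y)"
  shows "ord (x \<otimes> y) = ord x * ord y"
proof (rule dvd_antisym)
  show "ord (x \<otimes> y) dvd ord x * ord y"
    using comm x y by (rule ord_mul_divides)
  \<comment> \<open>Raising a * b to the exponent \<open>?k\<close> kills both the product and b,
    hence also a; coprimality then removes the factor \<open>ord b\<close>.\<close>
  have *: "ord a dvd ord (a \<otimes> b)"
    if "a \<in> carrier G" "b \<in> carrier G" "a \<otimes> b = b \<otimes> a" "coprime (ord a) (ord b)" for a b
  proof -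
    let ?k = "ord (a \<otimes> b) * ord b"
    have "a [^] ?k \<otimes> b [^] ?k = (a \<otimes> b) [^] ?k"
      using that by (intro pow_mult_distrib[symmetric]) auto
    also have "\<dots> = \<one>" using that by (simp add: pow_eq_id)
    also have "b [^] ?k = \<one>" using that by (simp add: pow_eq_id)
    finally have "ord a dvd ?k" using that by (simp add: pow_eq_id)
    with that show ?thesis by (simp add: coprime_dvd_mult_left_iff)
  qed
  show "ord x * ord y dvd ord (x \<otimes> y)"
    using *[of x y] *[of y x] x y comm cop by (auto intro!: divides_mult simp: coprime_commute)
qed

lemma funpow_eq_self_iff_card_orbit_dvd:
  assumes "permutation f"
  shows "(f ^^ k) x = x \<longleftrightarrow> card (orbit f x) dvd k"
proof -
  let ?d = "funpow_dist1 f x x"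
  have x: "x \<in> orbit f x" using assms by (rule permutation_self_in_orbit)
  have card: "card (orbit f x) = ?d"
    by (subst orbit_conv_funpow_dist1[OF x]) (simp add: card_image[OF inj_on_funpow_dist1[OF x]])
  have "(f ^^ ?d) x = x" using x by (rule funpow_dist1_prop)
  then have "(f ^^ k) x = (f ^^ (k mod ?d)) x" by (metis funpow_mod_eq)
  moreover have "(f ^^ (k mod ?d)) x = x \<longleftrightarrow> k mod ?d = 0"
    using funpow_dist1_least[of "k mod ?d" f x x] by (cases "k mod ?d = 0") auto
  ultimately show ?thesis unfolding card by (simp add: dvd_eq_mod_eq_0)
qed

text \<open>Iterates a + b \<le> ab for a, b \<ge> 2. It covers several prime powers dividing the
  length of one and the same cycle.\<close>

lemma sum_le_prod:
  fixes Q :: "nat set"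
  assumes "finite Q" "\<And>q. q \<in> Q \<Longrightarrow> q \<ge> 2"
  shows "\<Sum>Q \<le> \<Prod>Q"
  using assms
proof (induction Q rule: finite_induct)
  case (insert q Q)
  show ?case
  proof (cases "Q = {}")
    case False
    then obtain r where "r \<in> Q" by blast
    then have "r \<ge> 2" "r dvd \<Prod>Q" "\<Prod>Q > 0"
      using insert by (force intro: dvd_prodI prod_pos)+
    then have "\<Prod>Q \<ge> 2" using dvd_imp_le[of r "\<Prod>Q"] by linarith
    moreover have "q \<ge> 2" using insert.prems by simp
    ultimately have "q + \<Prod>Q \<le> q * \<Prod>Q"
    proof -
      obtain a where a: "q = a + 2" using \<open>q \<ge> 2\<close> le_Suc_ex by (metis add.commute)
      obtain b where b: "\<Prod>Q = b + 2" using \<open>\<Prod>Q \<ge> 2\<close> le_Suc_ex by (metis add.commute)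
      show ?thesis unfolding a b by (simp add: algebra_simps)
    qed
    moreover have "\<Sum>Q \<le> \<Prod>Q" using insert by simp
    moreover have "\<Sum>(insert q Q) = q + \<Sum>Q" "\<Prod>(insert q Q) = q * \<Prod>Q"
      using insert.hyps by simp_all
    ultimately show ?thesis by linarith
  qed (use insert in simp)
qed simp

lemma sym_group_nat_pow: "f [^]\<^bsub>sym_group n\<^esub> (k :: nat) = f ^^ k"
proof -
  interpret S: group "sym_group n" by (rule sym_group_is_group)
  show ?thesis
    by (induction k) (simp_all add: sym_group_one sym_group_mult funpow_Suc_right del: funpow.simps(2))
qed

lemma finite_carrier_sym_group: "finite (carrier (sym_group n))"
  by (simp add: sym_group_def finite_permutations)

lemma ord_sym_group_pos:
  assumes "f \<in> carrier (sym_group n)"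
  shows "group.ord (sym_group n) f > 0"
  using group.ord_ge_1[OF sym_group_is_group finite_carrier_sym_group assms] by simp

text \<open>Let q be a power of r and N the order of f. Since f^(N/r) is not the identity, it moves
  some x. The length of the cycle through x divides N but not N/r, so it contains the full r-part of
  N, and with it q.\<close>

lemma primepow_dvd_card_orbit:
  assumes f: "f \<in> carrier (sym_group n)" and q: "primepow q" "q dvd group.ord (sym_group n) f"
  obtains x where "x \<in> {1..n}" "q dvd card (orbit f x)"
proof -
  interpret S: group "sym_group n" by (rule sym_group_is_group)
  let ?N = "S.ord f"
  have per: "permutation f" and f': "f permutes {1..n}"
    using f by (auto simp: sym_group_carrier sym_group_carrier')
  have id_iff: "f ^^ k = id \<longleftrightarrow> ?N dvd k" for k
    using S.pow_eq_id[OF f, of k] by (simp add: sym_group_nat_pow sym_group_one)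
  obtain r k where r: "prime r" "k > 0" "q = r ^ k" using q by (auto simp: primepow_def)
  have "r dvd ?N" using r q by (metis dvd_power dvd_trans)
  have N: "?N > 0" using f by (rule ord_sym_group_pos)
  have "?N div r < ?N" using N r prime_gt_1_nat[of r] by simp
  moreover have "?N div r > 0"
    using N r \<open>r dvd ?N\<close> dvd_imp_le[of r ?N] by (simp add: div_greater_zero_iff prime_gt_0_nat)
  ultimately have "\<not> ?N dvd ?N div r" by (simp add: nat_dvd_not_less)
  then have "f ^^ (?N div r) \<noteq> id" by (simp add: id_iff)
  then obtain x where x: "(f ^^ (?N div r)) x \<noteq> x" by (metis eq_id_iff)
  let ?d = "card (orbit f x)"
  have "?d dvd ?N"
    using id_iff[of ?N] by (simp flip: funpow_eq_self_iff_card_orbit_dvd[OF per])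
  then obtain e where e: "?N = ?d * e" by blast
  have "\<not> r dvd e"
  proof
    assume "r dvd e"
    then have "?N div r = ?d * (e div r)" by (simp add: e div_mult_swap)
    with x show False by (simp add: funpow_eq_self_iff_card_orbit_dvd[OF per])
  qed
  then have "coprime q e" using r by (simp add: prime_imp_coprime)
  then have "q dvd ?d" using q(2) by (simp add: e coprime_dvd_mult_left_iff)
  moreover have "x \<in> {1..n}"
    using x permutes_funpow[OF f', of "?N div r"] permutes_not_in by metis
  ultimately show thesis by (intro that)
qed

lemma orbit_eq_if_inter:
  assumes "permutation f" "orbit f x \<inter> orbit f y \<noteq> {}"
  shows "orbit f x = orbit f y"
proof -
  obtain z where z: "z \<in> orbit f x" "z \<in> orbit f y" using assms(2) by blast
  have "orbit f z = orbit f w" if "z \<in> orbit f w" for w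
    by (rule orbit_cyclic_eq3[OF cyclic_on_orbit'[OF assms(1)] that])
  with z show ?thesis by metis
qed

text \<open>Each q divides the length of some cycle. The q assigned to one cycle are pairwise
  coprime, so their product divides its length and their sum is at most that length. Distinct cycles
  are disjoint subsets of the n points.\<close>

lemma sum_coprime_primepows_le:
  assumes f: "f \<in> carrier (sym_group n)" and Q: "coprime_primepows Q"
    and dvd: "\<And>q. q \<in> Q \<Longrightarrow> q dvd group.ord (sym_group n) f"
  shows "\<Sum>Q \<le> n"
proof -
  have per: "permutation f" and f': "f permutes {1..n}"
    using f by (auto simp: sym_group_carrier sym_group_carrier')
  have finQ: "finite Q" and ge2: "\<And>q. q \<in> Q \<Longrightarrow> q \<ge> 2"
    using Q by (force simp: coprime_primepows_def dest: primepow_gt_Suc_0)+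
  have "\<exists>x. x \<in> {1..n} \<and> q dvd card (orbit f x)" if "q \<in> Q" for q
  proof -
    have "primepow q" using Q that by (simp add: coprime_primepows_def)
    then show ?thesis using primepow_dvd_card_orbit[OF f] dvd[OF that] by metis
  qed
  then obtain X where X: "\<And>q. q \<in> Q \<Longrightarrow> X q \<in> {1..n}" "\<And>q. q \<in> Q \<Longrightarrow> q dvd card (orbit f (X q))"
    by metis
  define orb where "orb q = orbit f (X q)" for q
  have sub: "orb q \<subseteq> {1..n}" if "q \<in> Q" for q
    unfolding orb_def using permutes_orbit_subset[OF f'] X that by blast
  have "\<Sum>Q = (\<Sum>A\<in>orb ` Q. \<Sum>{q \<in> Q. orb q = A})"
    by (rule sum.image_gen[OF finQ])
  also have "\<dots> \<le> (\<Sum>A\<in>orb ` Q. card A)"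
  proof (rule sum_mono)
    fix A assume "A \<in> orb ` Q"
    then have A: "A \<subseteq> {1..n}" "A \<noteq> {}" using sub by (auto simp: orb_def orbit_nonempty)
    let ?R = "{q \<in> Q. orb q = A}"
    have "\<Sum>?R \<le> \<Prod>?R" using finQ ge2 by (intro sum_le_prod) auto
    also have "\<Prod>?R dvd card A"
      using Q X(2) by (intro prod_pairwise_coprime_dvd)
        (auto simp: coprime_primepows_def orb_def intro: pairwise_subset)
    then have "\<Prod>?R \<le> card A"
      using A by (intro dvd_imp_le) (auto simp: card_gt_0_iff intro: finite_subset)
    finally show "\<Sum>?R \<le> card A" .
  qed
  also have "\<dots> = card (\<Union>(orb ` Q))"
  proof (rule card_Union_disjoint[symmetric])
    show "disjoint (orb ` Q)"
      using orbit_eq_if_inter[OF per] by (auto simp: orb_def disjoint_def)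
  qed (use sub in \<open>auto intro: finite_subset\<close>)
  also have "\<dots> \<le> card {1..n}"
    using sub by (intro card_mono) auto
  finally show ?thesis by simp
qed

section \<open>Construction of permutations of prescribed order\<close>

lemma ord_cycle_of_list:
  assumes "distinct cs" "cs \<noteq> []" "set cs \<subseteq> {1..n}"
  shows "group.ord (sym_group n) (cycle_of_list cs) = length cs"
proof -
  interpret S: group "sym_group n" by (rule sym_group_is_group)
  have car: "cycle_of_list cs \<in> carrier (sym_group n)"
    using cycle_permutes[of cs] assms(3) by (auto simp: sym_group_carrier intro: permutes_subset)
  have "cycle_of_list cs ^^ k = id \<longleftrightarrow> length cs dvd k" for k
  proof
    assume "cycle_of_list cs ^^ k = id"
    \<comment> \<open>The k-th power of the cycle acts on the list \<open>cs\<close> as rotation by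
      k, and its entries are distinct.\<close>
    then have "rotate k cs = cs"
      using cyclic_rotation[OF assms(1), of k] by simp
    then have "cs ! (k mod length cs) = cs ! 0"
      using assms(2) nth_rotate[of 0 cs k] by simp
    then show "length cs dvd k"
      using assms by (simp add: nth_eq_iff_index_eq dvd_eq_mod_eq_0)
  next
    assume "length cs dvd k"
    then obtain j where "k = length cs * j" by blast
    then show "cycle_of_list cs ^^ k = id"
      using cycle_is_id_root[OF assms(1)] by (simp add: funpow_mult[symmetric])
  qed
  then show ?thesis
    by (simp add: S.ord_unique[OF car] sym_group_nat_pow sym_group_one)
qed

lemma comp_commute_disjoint_permutes:
  assumes "f permutes A" "g permutes B" "A \<inter> B = {}"
  shows "f \<circ> g = g \<circ> f"
proof
  fix x
  note f = permutes_not_in[OF assms(1)] permutes_in_image[OF assms(1)]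
  note g = permutes_not_in[OF assms(2)] permutes_in_image[OF assms(2)]
  consider "x \<in> A" "x \<notin> B" | "x \<in> B" "x \<notin> A" | "x \<notin> A" "x \<notin> B"
    using assms(3) by blast
  then show "(f \<circ> g) x = (g \<circ> f) x"
  proof cases
    case 1
    then have "f x \<notin> B" using assms(3) f by blast
    with 1 show ?thesis using g by simp
  next
    case 2
    then have "g x \<notin> A" using assms(3) g by blast
    with 2 show ?thesis using f by simp
  qed (use f g in simp)
qed

lemma ex_permutation_ord_prod:
  assumes "coprime_primepows Q" "\<Sum>Q \<le> n"
  obtains f where "f \<in> carrier (sym_group n)" "group.ord (sym_group n) f = \<Prod>Q"
proof -
  interpret S: group "sym_group n" by (rule sym_group_is_group)
  have "finite Q" using assms by (simp add: coprime_primepows_def)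
  \<comment> \<open>The induction also tracks a set \<open>Y\<close> of exactly
    \<open>\<Sum>Q\<close> points outside which f is the identity, so that enough free points remain
    for the next disjoint cycle.\<close>
  then have "\<exists>f Y. f permutes Y \<and> Y \<subseteq> {1..n} \<and> card Y = \<Sum>Q \<and> S.ord f = \<Prod>Q"
    using assms
  proof (induction Q rule: finite_induct)
    case empty
    have "S.ord id = 1" using S.ord_id by (simp only: sym_group_one)
    then have "id permutes {} \<and> {} \<subseteq> {1..n} \<and> card {} = \<Sum>{} \<and> S.ord id = \<Prod>{}"
      using permutes_id by (simp only: prod.empty sum.empty card.empty) auto
    then show ?case by blast
  next
    case (insert q Q)
    have q: "q > 0" "coprime q (\<Prod>Q)"
      using insert.prems insert.hyps
      by (auto simp: coprime_primepows_def pairwise_insert primepow_gt_0_nat intro!: prod_coprime_right)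
    obtain f Y where f: "f permutes Y" "Y \<subseteq> {1..n}" "card Y = \<Sum>Q" "S.ord f = \<Prod>Q"
      using insert by (auto simp: coprime_primepows_def pairwise_insert)
    have "q \<le> card ({1..n} - Y)"
      using insert f by (subst card_Diff_subset) (auto intro: finite_subset)
    then obtain A where A: "A \<subseteq> {1..n} - Y" "card A = q"
      by (meson obtain_subset_with_card_n)
    then obtain cs where cs: "set cs = A" "distinct cs"
      using finite_distinct_list[of A] by (meson finite_Diff finite_atLeastAtMost finite_subset)
    then have len: "length cs = q" using A distinct_card by fastforce
    let ?c = "cycle_of_list cs"
    have c: "?c permutes A" using cycle_permutes[of cs] cs by simp
    have ordc: "S.ord ?c = q"
      unfolding len[symmetric] by (rule ord_cycle_of_list) (use cs A len q in auto)
    have comm: "?c \<circ> f = f \<circ> ?c"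
      using comp_commute_disjoint_permutes[OF c f(1)] A by blast
    define h where "h = ?c \<circ> f"
    have "S.ord h = q * \<Prod>Q"
      using S.ord_mult_coprime[of ?c f] c f A q ordc comm
      by (auto simp: h_def sym_group_carrier sym_group_mult intro: permutes_subset)
    moreover have "h permutes A \<union> Y"
      unfolding h_def using c f by (auto intro!: permutes_compose intro: permutes_subset)
    moreover have "card (A \<union> Y) = q + \<Sum>Q"
      using A f by (subst card_Un_disjoint) (auto intro: finite_subset)
    ultimately show ?case
      using A f insert.hyps by (intro exI[of _ h] exI[of _ "A \<union> Y"]) auto
  qed
  then show thesis
    using that by (auto simp: sym_group_carrier intro: permutes_subset)
qed

section \<open>The reduced graph of the symmetric group\<close>

definition commuting_orders :: "nat \<Rightarrow> nat \<Rightarrow> nat \<Rightarrow> bool"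
  where "commuting_orders n a b \<longleftrightarrow>
    (\<exists>g \<in> carrier (sym_group n). \<exists>h \<in> carrier (sym_group n).
      group.ord (sym_group n) g = a \<and> group.ord (sym_group n) h = b \<and>
      g \<otimes>\<^bsub>sym_group n\<^esub> h = h \<otimes>\<^bsub>sym_group n\<^esub> g)"

lemma commuting_orders_commute: "commuting_orders n a b \<longleftrightarrow> commuting_orders n b a"
  unfolding commuting_orders_def by metis

text \<open>The element of order b is replaced by its (b/d)-th power, which still commutes with the
  other one.\<close>

lemma commuting_orders_ord_dvd:
  assumes "commuting_orders n a b" "d dvd b"
  shows "commuting_orders n a d"
proof -
  interpret S: group "sym_group n" by (rule sym_group_is_group)
  obtain g h where gh: "g \<in> carrier (sym_group n)" "h \<in> carrier (sym_group n)"
    "S.ord g = a" "S.ord h = b" "g \<otimes>\<^bsub>sym_group n\<^esub> h = h \<otimes>\<^bsub>sym_group n\<^esub> g"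
    using assms(1) unfolding commuting_orders_def by blast
  have b: "b > 0" using ord_sym_group_pos gh by blast
  obtain e where e: "b = d * e" using assms(2) by blast
  have "S.ord (h [^]\<^bsub>sym_group n\<^esub> e) = d"
    using S.ord_pow[of h e] gh b e by simp
  moreover have "h [^]\<^bsub>sym_group n\<^esub> e \<otimes>\<^bsub>sym_group n\<^esub> g = g \<otimes>\<^bsub>sym_group n\<^esub> h [^]\<^bsub>sym_group n\<^esub> e"
    using gh by (intro S.group_commutes_pow) auto
  ultimately show ?thesis
    unfolding commuting_orders_def using gh S.nat_pow_closed by metis
qed

lemma commuting_orders_self_dvd:
  assumes "g \<in> carrier (sym_group n)" "d dvd group.ord (sym_group n) g"
  shows "commuting_orders n (group.ord (sym_group n) g) d"
  using assms by (intro commuting_orders_ord_dvd[OF _ assms(2)]) (auto simp: commuting_orders_def)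

lemma ord_exists_if_dvd:
  assumes "g \<in> carrier (sym_group n)" "d dvd group.ord (sym_group n) g"
  obtains h where "h \<in> carrier (sym_group n)" "group.ord (sym_group n) h = d"
  using commuting_orders_self_dvd[OF assms] unfolding commuting_orders_def by blast

text \<open>The product of the two commuting elements has order \<open>p * \<Prod>Q\<close>, so the
  bound on sums applies to \<open>insert p Q\<close>.\<close>

lemma prime_add_sum_le_if_commuting_orders:
  assumes "commuting_orders n p (\<Prod>Q)" "prime p"
    and Q: "coprime_primepows Q" "\<And>q. q \<in> Q \<Longrightarrow> coprime p q"
  shows "p + \<Sum>Q \<le> n"
proof -
  interpret S: group "sym_group n" by (rule sym_group_is_group)
  obtain g h where gh: "g \<in> carrier (sym_group n)" "h \<in> carrier (sym_group n)"
    "S.ord g = p" "S.ord h = \<Prod>Q" "g \<otimes>\<^bsub>sym_group n\<^esub> h = h \<otimes>\<^bsub>sym_group n\<^esub> g"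
    using assms(1) unfolding commuting_orders_def by blast
  have fin: "finite Q" using Q(1) by (simp add: coprime_primepows_def)
  have p: "p \<notin> Q" using Q(2)[of p] assms(2) by auto
  have "coprime p (\<Prod>Q)" using Q(2) by (intro prod_coprime_right)
  then have ord: "S.ord (g \<otimes>\<^bsub>sym_group n\<^esub> h) = \<Prod>(insert p Q)"
    using S.ord_mult_coprime[of g h] gh p fin by simp
  have "\<Sum>(insert p Q) \<le> n"
  proof (rule sum_coprime_primepows_le)
    show "g \<otimes>\<^bsub>sym_group n\<^esub> h \<in> carrier (sym_group n)" using gh by simp
    show "coprime_primepows (insert p Q)"
      using Q assms(2) by (auto simp: coprime_primepows_def pairwise_insert coprime_commute)
    show "q dvd S.ord (g \<otimes>\<^bsub>sym_group n\<^esub> h)" if "q \<in> insert p Q" for q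
      unfolding ord using fin that by (intro dvd_prodI) auto
  qed
  then show ?thesis using p fin by simp
qed

lemma coprime_primepows_singleton [simp]: "coprime_primepows {q} \<longleftrightarrow> primepow q"
  by (simp add: coprime_primepows_def)

lemma commuting_orders_primes_iff:
  assumes "prime p" "prime q" "p \<noteq> q"
  shows "commuting_orders n p q \<longleftrightarrow> p + q \<le> n"
proof
  have cop: "coprime p q" using assms by (intro primes_coprime)
  assume "commuting_orders n p q"
  then show "p + q \<le> n"
    using prime_add_sum_le_if_commuting_orders[of n p "{q}"] assms cop
    by simp
next
  assume "p + q \<le> n"
  moreover have "coprime_primepows {p, q}"
    using assms by (auto intro: coprime_primepows_primes)
  ultimately obtain f where f: "f \<in> carrier (sym_group n)" "group.ord (sym_group n) f = p * q"
    using ex_permutation_ord_prod[of "{p, q}" n] assms by auto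
  \<comment> \<open>An element of order pq commutes with itself; one copy is now lowered to order q
    and the other to order p.\<close>
  have "commuting_orders n (p * q) (p * q)"
    using f by (auto simp: commuting_orders_def)
  then have "commuting_orders n (p * q) q"
    by (rule commuting_orders_ord_dvd) simp
  then have "commuting_orders n q (p * q)"
    by (simp add: commuting_orders_commute)
  then have "commuting_orders n q p"
    by (rule commuting_orders_ord_dvd) simp
  then show "commuting_orders n p q"
    by (simp add: commuting_orders_commute)
qed

lemma sum_coprime_primepows_le_singleton:
  assumes "g \<in> carrier (sym_group n)" "primepow q" "q dvd group.ord (sym_group n) g"
  shows "q \<le> n"
  using sum_coprime_primepows_le[of g n "{q}"] assms by simp

section \<open>Adjacency and distance expressed through element orders\<close>

definition order_adjacent :: "nat \<Rightarrow> (nat \<Rightarrow> nat) \<Rightarrow> (nat \<Rightarrow> nat) \<Rightarrow> bool"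
  where "order_adjacent n g h \<longleftrightarrow>
    group.ord (sym_group n) g = group.ord (sym_group n) h \<or>
    commuting_orders n (group.ord (sym_group n) g) (group.ord (sym_group n) h)"

lemma order_adjacent_sym: "order_adjacent n g h \<longleftrightarrow> order_adjacent n h g"
  unfolding order_adjacent_def using commuting_orders_commute by metis

text \<open>The distinctness of the commuting elements is accounted for as follows: different orders
  force distinct elements, and equal orders fall under the first disjunct of
  \<open>order_adjacent\<close>.\<close>

lemma parcs_order_super_commuting_graph_iff:
  "(g, h) \<in> parcs (order_super_commuting_graph (sym_group n)) \<longleftrightarrow>
     g \<in> carrier (sym_group n) \<and> h \<in> carrier (sym_group n) \<and> g \<noteq> h \<and> order_adjacent n g h"
proof -
  let ?o = "group.ord (sym_group n)"
  have "(\<exists>g' \<in> carrier (sym_group n). \<exists>h' \<in> carrier (sym_group n). ?o g' = ?o g \<and> ?o h' = ?o h \<and>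
      g' \<noteq> h' \<and> g' \<otimes>\<^bsub>sym_group n\<^esub> h' = h' \<otimes>\<^bsub>sym_group n\<^esub> g') \<longleftrightarrow> commuting_orders n (?o g) (?o h)"
    if "?o g \<noteq> ?o h"
    unfolding commuting_orders_def using that by metis
  then show ?thesis
    by (auto simp: order_super_commuting_graph_def order_adjacent_def)
qed

abbreviation reduced_sym_graph :: "nat \<Rightarrow> (nat \<Rightarrow> nat, (nat \<Rightarrow> nat) \<times> (nat \<Rightarrow> nat)) pre_digraph"
  where "reduced_sym_graph n \<equiv> reduced_order_super_commuting_graph (sym_group n)"

lemma verts_reduced_sym_graph_iff:
  "g \<in> verts (reduced_sym_graph n) \<longleftrightarrow>
     g \<in> carrier (sym_group n) \<and> (\<exists>h \<in> carrier (sym_group n). h \<noteq> g \<and> \<not> order_adjacent n g h)"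
proof -
  have "pverts (order_super_commuting_graph (sym_group n)) = carrier (sym_group n)"
    by (simp add: order_super_commuting_graph_def)
  then show ?thesis
    by (auto simp: reduced_order_super_commuting_graph_def Let_def dominant_vertex_def
        parcs_order_super_commuting_graph_iff)
qed

lemma dominates_reduced_sym_graph_iff:
  "g \<rightarrow>\<^bsub>reduced_sym_graph n\<^esub> h \<longleftrightarrow>
     g \<in> verts (reduced_sym_graph n) \<and> h \<in> verts (reduced_sym_graph n) \<and> g \<noteq> h \<and> order_adjacent n g h"
proof -
  have "g \<rightarrow>\<^bsub>reduced_sym_graph n\<^esub> h \<longleftrightarrow>
     g \<in> verts (reduced_sym_graph n) \<and> h \<in> verts (reduced_sym_graph n) \<and>
     (g, h) \<in> parcs (order_super_commuting_graph (sym_group n))"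
    by (auto simp: reduced_order_super_commuting_graph_def Let_def arcs_ends_def arc_to_ends_def image_iff)
  then show ?thesis
    by (simp only: parcs_order_super_commuting_graph_iff) (auto simp: verts_reduced_sym_graph_iff)
qed

lemma symmetric_reduced_sym_graph: "symmetric (reduced_sym_graph n)"
  unfolding symmetric_def sym_def
  using dominates_reduced_sym_graph_iff order_adjacent_sym by metis

lemma wf_digraph_reduced_sym_graph: "wf_digraph (reduced_sym_graph n)"
  by unfold_locales (auto simp: reduced_order_super_commuting_graph_def Let_def)

text \<open>\<open>order_adjacent\<close> is reflexive, so consecutive vertices may coincide; each
  step then costs an empty walk instead of one arc.\<close>

lemma graph_dist_le_3:
  assumes "u \<in> verts (reduced_sym_graph n)" "w1 \<in> verts (reduced_sym_graph n)"
    and "w2 \<in> verts (reduced_sym_graph n)" "v \<in> verts (reduced_sym_graph n)"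
    and "order_adjacent n u w1" "order_adjacent n w1 w2" "order_adjacent n w2 v"
  shows "graph_dist (reduced_sym_graph n) u v \<le> 3"
proof -
  interpret R: wf_digraph "reduced_sym_graph n" by (rule wf_digraph_reduced_sym_graph)
  have step: "\<exists>P. R.awalk x P y \<and> length P \<le> 1"
    if "x \<in> verts (reduced_sym_graph n)" "y \<in> verts (reduced_sym_graph n)" "order_adjacent n x y" for x y
  proof (cases "x = y")
    case True
    then show ?thesis using that by (intro exI[of _ "[]"]) (simp add: R.awalk_Nil_iff)
  next
    case False
    then have "x \<rightarrow>\<^bsub>reduced_sym_graph n\<^esub> y" using that by (simp add: dominates_reduced_sym_graph_iff)
    then obtain e where "e \<in> arcs (reduced_sym_graph n)"
      "tail (reduced_sym_graph n) e = x" "head (reduced_sym_graph n) e = y"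
      by (auto simp: arcs_ends_def arc_to_ends_def)
    then show ?thesis using that by (intro exI[of _ "[e]"]) (simp add: R.awalk_simps)
  qed
  obtain P1 P2 P3 where P: "R.awalk u P1 w1" "R.awalk w1 P2 w2" "R.awalk w2 P3 v"
    "length P1 \<le> 1" "length P2 \<le> 1" "length P3 \<le> 1"
    using step assms by meson
  let ?P = "P1 @ P2 @ P3"
  have "R.awalk u ?P v" using P by (meson R.awalk_appendI)
  then have "R.\<mu> (\<lambda>_. 1) u v \<le> ereal (R.awalk_cost (\<lambda>_. 1) ?P)"
    by (rule R.min_cost_le_walk_cost)
  also have "R.awalk_cost (\<lambda>_. 1) ?P = length ?P"
    by (simp add: R.awalk_cost_def sum_list_triv)
  also have "ereal (length ?P) \<le> 3"
    using P by simp
  finally show ?thesis by (simp add: graph_dist_def)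
qed

section \<open>Vertices and short paths in the reduced graph\<close>

lemma prime_ord_in_reduced_sym_graph:
  assumes "n \<ge> 3" "g \<in> carrier (sym_group n)" "prime (group.ord (sym_group n) g)"
  shows "g \<in> verts (reduced_sym_graph n)"
proof -
  let ?p = "group.ord (sym_group n) g"
  obtain Q where Q: "coprime_primepows Q" "\<And>q. q \<in> Q \<Longrightarrow> coprime ?p q" "\<Sum>Q \<le> n" "n < \<Sum>Q + ?p"
    using prime_window[OF assms(3,1)] by blast
  obtain f where f: "f \<in> carrier (sym_group n)" "group.ord (sym_group n) f = \<Prod>Q"
    using ex_permutation_ord_prod Q by blast
  have "coprime ?p (\<Prod>Q)" using Q(2) by (intro prod_coprime_right)
  then have "?p \<noteq> \<Prod>Q" using assms(3) by auto
  \<comment> \<open>Commuting elements of these orders would require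
    \<open>?p + \<Sum>Q \<le> n\<close>, which the choice of the window excludes.\<close>
  moreover have "\<not> commuting_orders n ?p (\<Prod>Q)"
    using prime_add_sum_le_if_commuting_orders[of n ?p Q] Q assms(3) by fastforce
  ultimately have "f \<noteq> g" "\<not> order_adjacent n g f"
    using f by (auto simp: order_adjacent_def)
  then show ?thesis using f assms(2) by (auto simp: verts_reduced_sym_graph_iff)
qed

lemma ord_ne_1_reduced_sym_graph:
  assumes "g \<in> verts (reduced_sym_graph n)"
  shows "group.ord (sym_group n) g \<noteq> 1"
proof
  interpret S: group "sym_group n" by (rule sym_group_is_group)
  assume ord: "S.ord g = 1"
  obtain h where h: "g \<in> carrier (sym_group n)" "h \<in> carrier (sym_group n)" "\<not> order_adjacent n g h"
    using assms by (auto simp: verts_reduced_sym_graph_iff)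
  have "commuting_orders n (S.ord h) 1"
    using h by (intro commuting_orders_self_dvd) auto
  with h ord show False
    by (simp add: order_adjacent_def commuting_orders_commute)
qed

lemma prime_order_vertex:
  assumes "n \<ge> 3" "prime p" "p \<le> n"
  obtains g where "g \<in> verts (reduced_sym_graph n)" "group.ord (sym_group n) g = p"
proof -
  obtain g where "g \<in> carrier (sym_group n)" "group.ord (sym_group n) g = p"
    using ex_permutation_ord_prod[of "{p}" n] assms by auto
  then show thesis using prime_ord_in_reduced_sym_graph assms that by blast
qed

text \<open>A prime divisor r of b other than p would need p + r \<le> n, so b is a power of p. The
  case that p^2 divides b would need p^2 \<le> n, while p \<ge> 3 gives p^2 \<ge> 3p > n.\<close>

lemma commuting_orders_prime_gt:
  assumes "commuting_orders n p b" "prime p" "n < p + 2" "n \<ge> 4" "b \<noteq> 1"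
  shows "b = p"
proof (rule ccontr)
  assume "b \<noteq> p"
  have dvd: "r = p" if "prime r" "r dvd b" for r
  proof (rule ccontr)
    assume "r \<noteq> p"
    then have "p + r \<le> n"
      using commuting_orders_ord_dvd[OF assms(1) that(2)] commuting_orders_primes_iff that assms by metis
    with assms prime_ge_2_nat[OF that(1)] show False by linarith
  qed
  obtain e where e: "b = p * e"
    using prime_factor_nat[OF assms(5)] dvd by blast
  with \<open>b \<noteq> p\<close> obtain r where "prime r" "r dvd e"
    using prime_factor_nat[of e] by auto
  moreover from this have "r = p" using dvd e by simp
  ultimately have "p\<^sup>2 dvd b" by (simp add: e power2_eq_square)
  moreover obtain h where "h \<in> carrier (sym_group n)" "group.ord (sym_group n) h = b"
    using assms(1) unfolding commuting_orders_def by blast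
  ultimately have "p\<^sup>2 \<le> n"
    using sum_coprime_primepows_le_singleton[of h n "p\<^sup>2"] assms(2) by simp
  moreover have "3 * p \<le> p\<^sup>2" using assms by (simp add: power2_eq_square)
  ultimately show False using assms by linarith
qed

text \<open>If p > n - 2, every walk starting at an element of order p stays among elements of order
  p and never reaches an involution; note that p > 2 because n \<ge> 4.\<close>

lemma prime_add_2_le_if_connected:
  assumes n: "n \<ge> 4" and con: "Digraph_Component.connected (reduced_sym_graph n)"
    and p: "prime p" "p \<le> n"
  shows "p + 2 \<le> n"
proof (rule ccontr)
  assume gt: "\<not> p + 2 \<le> n"
  interpret R: wf_digraph "reduced_sym_graph n" by (rule wf_digraph_reduced_sym_graph)
  obtain u where u: "u \<in> verts (reduced_sym_graph n)" "group.ord (sym_group n) u = p"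
    using prime_order_vertex[of n p] p n by auto
  obtain v where v: "v \<in> verts (reduced_sym_graph n)" "group.ord (sym_group n) v = 2"
    using prime_order_vertex[of n 2] n by auto
  have "u \<rightarrow>\<^sup>*\<^bsub>reduced_sym_graph n\<^esub> v"
    using R.symmetric_connected_imp_strongly_connected[OF symmetric_reduced_sym_graph con] u v
    by (auto simp: strongly_connected_def)
  then have "group.ord (sym_group n) v = p"
  proof (induction rule: R.reachable_induct)
    case (step x y)
    then have y: "y \<in> verts (reduced_sym_graph n)" and "order_adjacent n x y"
      by (simp_all add: dominates_reduced_sym_graph_iff)
    then show ?case
      using step commuting_orders_prime_gt[of n p "group.ord (sym_group n) y"]
        ord_ne_1_reduced_sym_graph[OF y] p gt n
      by (auto simp: order_adjacent_def)
  qed (use u in simp)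
  with v gt n show False by simp
qed

text \<open>Any further prime factor r of the order contradicts \<open>large\<close>: if r = q, then
  n \<ge> q^2 \<ge> 2q > p + q; if r differs from q, then n \<ge> q + r > p + r.\<close>

lemma ord_eq_prime_if_sums_large:
  assumes v: "v \<in> carrier (sym_group n)"
    and q: "prime q" "q dvd group.ord (sym_group n) v" "p < q"
    and large: "\<And>r. prime r \<Longrightarrow> r dvd group.ord (sym_group n) v \<Longrightarrow> n < p + r"
  shows "group.ord (sym_group n) v = q"
proof (rule ccontr)
  assume ne: "group.ord (sym_group n) v \<noteq> q"
  obtain e where e: "group.ord (sym_group n) v = q * e" using q by blast
  with ne obtain r where r: "prime r" "r dvd e" using prime_factor_nat[of e] by auto
  have rv: "r dvd group.ord (sym_group n) v" using r e by simp
  show False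
  proof (cases "r = q")
    case True
    then have "q\<^sup>2 dvd group.ord (sym_group n) v" using r e by (simp add: power2_eq_square)
    then have "q\<^sup>2 \<le> n"
      using sum_coprime_primepows_le_singleton[OF v, of "q\<^sup>2"] q by simp
    moreover have "2 * q \<le> q\<^sup>2" using prime_ge_2_nat[OF q(1)] by (simp add: power2_eq_square)
    ultimately show False using large[OF q(1,2)] q by linarith
  next
    case False
    have "coprime_primepows {q, r}" using q r by (auto intro: coprime_primepows_primes)
    then have "q + r \<le> n"
      using sum_coprime_primepows_le[OF v, of "{q, r}"] q rv False by auto
    then show False using large[OF r(1) rv] q by linarith
  qed
qed

lemma ex_prime_order_neighbour:
  assumes "n \<ge> 4" "u \<in> verts (reduced_sym_graph n)" "prime p" "p dvd group.ord (sym_group n) u"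
  obtains w where "w \<in> verts (reduced_sym_graph n)" "group.ord (sym_group n) w = p" "order_adjacent n u w"
proof -
  have u: "u \<in> carrier (sym_group n)" using assms by (simp add: verts_reduced_sym_graph_iff)
  obtain w where w: "w \<in> carrier (sym_group n)" "group.ord (sym_group n) w = p"
    using ord_exists_if_dvd[OF u assms(4)] by blast
  show thesis
  proof (rule that)
    show "w \<in> verts (reduced_sym_graph n)"
      using w assms by (intro prime_ord_in_reduced_sym_graph) auto
    show "order_adjacent n u w"
      using w commuting_orders_self_dvd[OF u assms(4)] by (simp add: order_adjacent_def)
  qed (use w in simp)
qed

text \<open>Since the order of v is exactly q, connectedness places v itself, and not just a power
  of it, next to the involutions. The element of order p obtained from u is next to them as
  well.\<close>

lemma path_through_involution:
  assumes n: "n \<ge> 4" and con: "Digraph_Component.connected (reduced_sym_graph n)"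
    and u: "u \<in> verts (reduced_sym_graph n)" "prime p" "p dvd group.ord (sym_group n) u"
    and v: "v \<in> verts (reduced_sym_graph n)" "prime q" "q dvd group.ord (sym_group n) v"
    and "p < q"
    and large: "\<And>r. prime r \<Longrightarrow> r dvd group.ord (sym_group n) v \<Longrightarrow> n < p + r"
  shows "\<exists>w1 \<in> verts (reduced_sym_graph n). \<exists>w2 \<in> verts (reduced_sym_graph n).
    order_adjacent n u w1 \<and> order_adjacent n w1 w2 \<and> order_adjacent n w2 v"
proof -
  have car: "u \<in> carrier (sym_group n)" "v \<in> carrier (sym_group n)"
    using u v by (simp_all add: verts_reduced_sym_graph_iff)
  have "p \<le> n" "q \<le> n"
    using sum_coprime_primepows_le_singleton car u v by simp_all
  then have le: "p + 2 \<le> n" "q + 2 \<le> n"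
    using prime_add_2_le_if_connected[OF n con] u v by simp_all
  obtain w1 where w1: "w1 \<in> verts (reduced_sym_graph n)" "group.ord (sym_group n) w1 = p" "order_adjacent n u w1"
    using ex_prime_order_neighbour[OF n u] by blast
  obtain w2 where w2: "w2 \<in> verts (reduced_sym_graph n)" "group.ord (sym_group n) w2 = 2"
    using prime_order_vertex[of n 2] n by auto
  have "group.ord (sym_group n) v = q"
    using ord_eq_prime_if_sums_large[OF car(2) v(2,3) \<open>p < q\<close> large] .
  moreover have "r = 2 \<or> commuting_orders n r 2" if "prime r" "r + 2 \<le> n" for r
    using that commuting_orders_primes_iff[of r 2 n] by auto
  ultimately have "order_adjacent n w1 w2" "order_adjacent n v w2"
    using le u v w1 w2 by (auto simp: order_adjacent_def)
  then show ?thesis using w1 w2 order_adjacent_sym by blast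
qed

lemma short_path:
  assumes n: "n \<ge> 4" and con: "Digraph_Component.connected (reduced_sym_graph n)"
    and u: "u \<in> verts (reduced_sym_graph n)" and v: "v \<in> verts (reduced_sym_graph n)"
  shows "\<exists>w1 \<in> verts (reduced_sym_graph n). \<exists>w2 \<in> verts (reduced_sym_graph n).
    order_adjacent n u w1 \<and> order_adjacent n w1 w2 \<and> order_adjacent n w2 v"
proof -
  let ?o = "group.ord (sym_group n)"
  obtain p where p: "prime p" "p dvd ?o u"
    using prime_factor_nat[OF ord_ne_1_reduced_sym_graph[OF u]] by blast
  obtain q where q: "prime q" "q dvd ?o v"
    using prime_factor_nat[OF ord_ne_1_reduced_sym_graph[OF v]] by blast
  show ?thesis
  proof (cases "\<exists>p q. prime p \<and> p dvd ?o u \<and> prime q \<and> q dvd ?o v \<and> (p = q \<or> p + q \<le> n)")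
    case True
    then obtain p q where pq: "prime p" "p dvd ?o u" "prime q" "q dvd ?o v" "p = q \<or> p + q \<le> n"
      by blast
    obtain w1 where w1: "w1 \<in> verts (reduced_sym_graph n)" "?o w1 = p" "order_adjacent n u w1"
      using ex_prime_order_neighbour[OF n u pq(1,2)] by blast
    obtain w2 where w2: "w2 \<in> verts (reduced_sym_graph n)" "?o w2 = q" "order_adjacent n v w2"
      using ex_prime_order_neighbour[OF n v pq(3,4)] by blast
    have "order_adjacent n w1 w2"
      using pq w1 w2 commuting_orders_primes_iff[of p q n] by (auto simp: order_adjacent_def)
    with w1 w2 show ?thesis using order_adjacent_sym by blast
  next
    case False
    have large: "n < p' + q' \<and> p' \<noteq> q'"
      if "prime p'" "p' dvd ?o u" "prime q'" "q' dvd ?o v" for p' q'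
    proof (rule ccontr)
      assume "\<not> ?thesis"
      then have "p' = q' \<or> p' + q' \<le> n" by linarith
      with False that show False by blast
    qed
    consider "p < q" | "q < p" using large[OF p q] by linarith
    then show ?thesis
    proof cases
      case 1
      then show ?thesis
        using path_through_involution[OF n con u p v q] large[OF p] by blast
    next
      case 2
      \<comment> \<open>The roles of u and v are exchanged, and the path found is then traversed
        backwards.\<close>
      then have "\<exists>w1 \<in> verts (reduced_sym_graph n). \<exists>w2 \<in> verts (reduced_sym_graph n).
          order_adjacent n v w1 \<and> order_adjacent n w1 w2 \<and> order_adjacent n w2 u"
        using path_through_involution[OF n con v q u p] large[OF _ _ q] by (simp add: add.commute)
      then show ?thesis using order_adjacent_sym by blast
    qed
  qed
qed

theorem theorem4p11:
  fixes n :: nat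
  assumes "n \<ge> 4"
    and "Digraph_Component.connected (reduced_order_super_commuting_graph (sym_group n))"
  shows "graph_diameter (reduced_order_super_commuting_graph (sym_group n)) \<le> 3"
  unfolding graph_diameter_def
proof (intro SUP_least)
  fix u v
  assume "u \<in> verts (reduced_sym_graph n)" "v \<in> verts (reduced_sym_graph n)"
  then show "graph_dist (reduced_sym_graph n) u v \<le> 3"
    using short_path[OF assms] graph_dist_le_3 by meson
qed

end
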